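(* Let $k\ge 3$, let $\mathcal{D}=(P,\mathcal{B})$ be a symmetric $(2^k-1,2^{k-1},2^{k-2})$-design and let $O$ be a center block of $\mathcal{D}$ such that for every $(2^{k-1}-1)$-element subset $Z\subset O$ the design $\mathcal{D}_Z$ is isomorphic to the design of points and hyperplane complements of $\mathrm{PG}(k-2,2)$. Then the full automorphism group of $\mathcal{D}$ contains a subgroup isomorphic to $C_2^{k-1}$ which acts sharply transitively on $O$ and leaves every point of $O^c=P\setminus O$ fixed.
   Context: A symmetric $(v,\kappa,\lambda)$-design is a pair $\mathcal{D}=(P,\mathcal{B})$, where $P$ is a set of $v$ points and $\mathcal{B}$ is a set of precisely $v$ subsets of $P$, called blocks, each consisting of $\kappa$ points, such that any two distinct blocks intersect in precisely $\lambda$ points. An isomorphism of designs is a bijection between the point sets that maps blocks to blocks (inducing a bijection of the block sets); an automorphism is an isomorphism of a design to itself. Sharply transitive means transitive with trivial point stabilizers. $C_2^{k-1}$ is the direct product of $k-1$ copies of the cyclic group of order $2$. The design of points and hyperplane complements of $\mathrm{PG}(d,2)$ has the points of $\mathrm{PG}(d,2)$ as points and the complements of hyperplanes as blocks. Let $\mathcal{D}=(P,\mathcal{B})$ be a symmetric $(2^k-1,2^{k-1},2^{k-2})$-design with $k\ge 3$. A block $O\in\mathcal{B}$ is a center block if for every block $B\neq O$ the symmetric difference $O\triangle B$ is a block. If $O$ is a center block, then for every $(2^{k-1}-1)$-element subset $Z\subset O$ the pair $\mathcal{D}_Z=(Z,\mathcal{B}_Z)$ with $\mathcal{B}_Z=\{B\cap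 O: B\in\mathcal{B},\,B\ne O,\,B\cap O\subset Z\}$ is known to be a symmetric $(2^{k-1}-1,2^{k-2},2^{k-3})$-design. *)

theory Defs
  imports
    Complex_Main
    "HOL-Library.Function_Algebras"
    "HOL-Library.Z2"
    "HOL-Algebra.Group_Action"
    "HOL-Algebra.Product_Groups"
begin

type_synonym 'a design = "'a set \<times> 'a set set"

fun symmetric_design :: "nat \<Rightarrow> nat \<Rightarrow> nat \<Rightarrow> 'a design \<Rightarrow> bool" where
  "symmetric_design v \<kappa> l (P, \<B>) \<longleftrightarrow>
     finite P \<and> card P = v \<and> \<B> \<subseteq> Pow P \<and> finite \<B> \<and> card \<B> = v \<and>
     (\<forall>B\<in>\<B>. card B = \<kappa>) \<and>
     (\<forall>B\<in>\<B>. \<forall>B'\<in>\<B>. B \<noteq> B' \<longrightarrow> card (B \<inter> B') = l)"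

fun design_iso :: "'a design \<Rightarrow> 'b design \<Rightarrow> ('a \<Rightarrow> 'b) \<Rightarrow> bool" where
  "design_iso (P, \<B>) (P', \<B>') f \<longleftrightarrow> bij_betw f P P' \<and> bij_betw ((`) f) \<B> \<B>'"

definition design_isomorphic :: "'a design \<Rightarrow> 'b design \<Rightarrow> bool" where
  "design_isomorphic D D' \<longleftrightarrow> (\<exists>f. design_iso D D' f)"

definition aut_group :: "'a design \<Rightarrow> ('a \<Rightarrow> 'a) monoid" where
  "aut_group D = (BijGroup (fst D)) \<lparr>carrier := {f \<in> Bij (fst D). design_iso D D f}\<rparr>"

fun center_block :: "'a design \<Rightarrow> 'a set \<Rightarrow> bool" where
  "center_block (P, \<B>) C \<longleftrightarrow> C \<in> \<B> \<and> (\<forall>B\<in>\<B>. B \<noteq> C \<longrightarrow> sym_diff C B \<in> \<B>)"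

fun derived_design :: "'a design \<Rightarrow> 'a set \<Rightarrow> 'a set \<Rightarrow> 'a design" where
  "derived_design (P, \<B>) C Z = (Z, {B \<inter> C | B. B \<in> \<B> \<and> B \<noteq> C \<and> B \<inter> C \<subseteq> Z})"


text \<open>
  The coordinate space of dimension \<open>n\<close> over the field with two elements consists of the
  sequences of bits that vanish from index \<open>n\<close> on.
\<close>

definition gf2_scale :: "bit \<Rightarrow> (nat \<Rightarrow> bit) \<Rightarrow> nat \<Rightarrow> bit" where
  "gf2_scale c x = (\<lambda>i. c * x i)"

interpretation gf2: vector_space gf2_scale
  by unfold_locales (auto simp: gf2_scale_def fun_eq_iff algebra_simps)

definition gf2_space :: "nat \<Rightarrow> (nat \<Rightarrow> bit) set" where
  "gf2_space n = {x. \<forall>i\<ge>n. x i = 0}"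

definition gf2_subspaces :: "nat \<Rightarrow> nat \<Rightarrow> (nat \<Rightarrow> bit) set set" where
  "gf2_subspaces n m = {U. gf2.subspace U \<and> U \<subseteq> gf2_space n \<and> gf2.dim U = m}"

definition pg2_points :: "nat \<Rightarrow> (nat \<Rightarrow> bit) set set" where
  "pg2_points d = gf2_subspaces (d + 1) 1"

definition pg2_hyperplanes :: "nat \<Rightarrow> (nat \<Rightarrow> bit) set set set" where
  "pg2_hyperplanes d = (\<lambda>U. {p \<in> pg2_points d. p \<subseteq> U}) ` gf2_subspaces (d + 1) d"

definition pg2_complement_design :: "nat \<Rightarrow> (nat \<Rightarrow> bit) set design" where
  "pg2_complement_design d = (pg2_points d, {pg2_points d - H | H. H \<in> pg2_hyperplanes d})"


text \<open>
  The group \<open>G\<close> consists of permutations of a set containing \<open>X\<close>. That \<open>X\<close> is invariant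
  under \<open>G\<close> is part of \<^const>\<open>transitive_action\<close>, which requires all the restrictions to be
  permutations of \<open>X\<close>.
\<close>

definition sharply_transitive_on :: "('a \<Rightarrow> 'a) monoid \<Rightarrow> 'a set \<Rightarrow> bool" where
  "sharply_transitive_on G X \<longleftrightarrow>
     transitive_action G X (\<lambda>g. restrict g X) \<and>
     (\<forall>x\<in>X. stabilizer G (\<lambda>g. restrict g X) x = {\<one>\<^bsub>G\<^esub>})"

end

theory Submission
  imports Defs
begin

text \<open>
  A single derived design carries all the information. Fix a point \<open>z\<close> of the center block \<open>C\<close>
  and put \<open>Z = C - {z}\<close>. Over the field with two elements the points of a projective space are
  the nonzero vectors, so an isomorphism from the derived design on \<open>Z\<close> to the design of
  hyperplane complements labels the points of \<open>Z\<close> by the nonzero vectors of a coordinate space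
  \<open>V\<close> of dimension \<open>k - 1\<close>. Labelling \<open>z\<close> by the zero vector makes \<open>C\<close> an affine
  space over \<open>V\<close> (lemma \<open>pg2_complement_design_labelling\<close>). The group sought consists of the
  translations of this affine space, extended by the identity outside \<open>C\<close>; it is a copy of
  the additive group of \<open>V\<close> and acts sharply transitively on \<open>C\<close> by construction.

  What has to be seen is that translations map blocks to blocks. The blocks \<open>B\<close> and
  \<open>sym_diff C B\<close> have complementary traces on \<open>C\<close>, and exactly one of these traces avoids
  \<open>z\<close> and hence is a block of the derived design. So the trace of every block other than
  \<open>C\<close> is the set of points labelled by a hyperplane \<open>U\<close> of \<open>V\<close> or by its complement. As
  \<open>U\<close> has index two (lemma \<open>add_in_hyperplane_iff\<close>), a translation either preserves this
  trace or replaces it by its complement in \<open>C\<close>. In the first case it maps \<open>B\<close> to itself, in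
  the second to \<open>sym_diff C B\<close> (lemma \<open>shift_image_cases\<close>), which is a block because \<open>C\<close>
  is a center block.
\<close>

section \<open>Points and hyperplanes of binary projective space\<close>

lemma gf2_add_self [simp]: "x + x = (0 :: nat \<Rightarrow> bit)"
  by (simp add: fun_eq_iff)

lemma gf2_add_self_left [simp]: "x + (x + y) = (y :: nat \<Rightarrow> bit)"
  by (metis add.assoc add_0 gf2_add_self)

lemma gf2_add_self_right [simp]: "(y + x) + x = (y :: nat \<Rightarrow> bit)"
  by (metis add.assoc add_0_right gf2_add_self)

lemma gf2_diff_eq_add: "x - y = (x + y :: nat \<Rightarrow> bit)"
  by (metis add_diff_cancel_right' gf2_add_self_right)

lemma gf2_scale_simps [simp]: "gf2_scale 0 x = 0" "gf2_scale 1 x = x"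
  by (auto simp: gf2_scale_def fun_eq_iff)

lemma zero_in_gf2_space [simp]: "0 \<in> gf2_space n"
  by (simp add: gf2_space_def)

lemma add_in_gf2_space: "x \<in> gf2_space n \<Longrightarrow> y \<in> gf2_space n \<Longrightarrow> x + y \<in> gf2_space n"
  by (simp add: gf2_space_def)

lemma gf2_span_singleton: "gf2.span {v} = {0, v}"
  unfolding gf2.span_singleton
  by (auto simp: image_iff) (metis bit_not_one_iff gf2_scale_simps)+

lemma gf2_space_subset_span:
  "gf2_space n \<subseteq> gf2.span ((\<lambda>i j. if j = i then 1 else 0) ` {..<n})"
proof
  fix x assume x: "x \<in> gf2_space n"
  let ?e = "\<lambda>i j. (if j = i then 1 else 0) :: bit"
  have *: "(\<Sum>i\<in>A. gf2_scale (x i) (?e i)) j = (if j \<in> A then x j else 0)"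
    if "finite A" for A :: "nat set" and j
    using that by (induction A) (auto simp: gf2_scale_def)
  have "x = (\<Sum>i<n. gf2_scale (x i) (?e i))"
    using x by (auto simp: fun_eq_iff * gf2_space_def)
  also have "\<dots> \<in> gf2.span (?e ` {..<n})"
    by (intro gf2.span_sum gf2.span_scale gf2.span_base) auto
  finally show "x \<in> gf2.span (?e ` {..<n})" .
qed

lemma card_gf2_independent_le:
  assumes "gf2.independent S" "S \<subseteq> gf2_space n"
  shows "finite S \<and> card S \<le> n"
proof -
  let ?T = "(\<lambda>i j. if j = i then 1 else 0 :: bit) ` {..<n}"
  have "finite S \<and> card S \<le> card ?T"
    using assms gf2_space_subset_span by (intro gf2.independent_span_bound) auto
  moreover have "card ?T \<le> n"
    using card_image_le[of "{..<n}"] by simp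
  ultimately show ?thesis
    by simp
qed

text \<open>
  A hyperplane has index two: two vectors \<open>x\<close>, \<open>y\<close> outside of it lie in the same coset, for
  otherwise a basis of the hyperplane together with \<open>x\<close> and \<open>y\<close> would be an independent family
  with more members than the dimension of the whole space.
\<close>

lemma add_in_hyperplane_iff:
  assumes U: "U \<in> gf2_subspaces (Suc d) d"
    and x: "x \<in> gf2_space (Suc d)" and y: "y \<in> gf2_space (Suc d)"
  shows "x + y \<in> U \<longleftrightarrow> (x \<in> U \<longleftrightarrow> y \<in> U)"
proof -
  have sub: "gf2.subspace U" "U \<subseteq> gf2_space (Suc d)" and dim: "gf2.dim U = d"
    using U by (auto simp: gf2_subspaces_def)
  note add = gf2.subspace_add[OF sub(1)]
  have "x + y \<in> U" if "x \<notin> U" "y \<notin> U"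
  proof (rule ccontr)
    assume xy: "x + y \<notin> U"
    obtain B where B: "B \<subseteq> U" "gf2.independent B" "U \<subseteq> gf2.span B" "card B = d"
      using gf2.basis_exists[of U] dim by metis
    have span: "gf2.span B = U"
      using B sub gf2.span_minimal by blast
    have indx: "gf2.independent (insert x B)"
      using B \<open>x \<notin> U\<close> span by (intro gf2.independent_insertI) auto
    have "y \<notin> gf2.span (insert x B)"
    proof
      assume "y \<in> gf2.span (insert x B)"
      then obtain c where "y - gf2_scale c x \<in> U"
        by (auto simp: gf2.span_breakdown_eq span)
      then show False
        using \<open>y \<notin> U\<close> xy by (cases c) (auto simp: gf2_diff_eq_add add.commute)
    qed
    then have "gf2.independent (insert y (insert x B))"
      using indx by (rule gf2.independent_insertI)
    moreover have "insert y (insert x B) \<subseteq> gf2_space (Suc d)"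
      using B sub x y by auto
    ultimately have "finite (insert y (insert x B))" "card (insert y (insert x B)) \<le> Suc d"
      using card_gf2_independent_le[of "insert y (insert x B)"] by simp_all
    moreover have "x \<notin> B" "y \<notin> B" "x \<noteq> y"
      using that B xy gf2.subspace_0[OF sub(1)] by auto
    ultimately show False
      using B by simp
  qed
  moreover have "y \<in> U" if "x + y \<in> U" "x \<in> U"
    using add[OF that(2,1)] by simp
  moreover have "x \<in> U" if "x + y \<in> U" "y \<in> U"
    using add[OF that(1,2)] by simp
  ultimately show ?thesis
    using add by blast
qed

lemma pg2_points_eq: "pg2_points d = (\<lambda>v. {0, v}) ` (gf2_space (Suc d) - {0})"
proof (intro equalityI subsetI)
  fix p assume p: "p \<in> pg2_points d"
  then have sub: "gf2.subspace p" "p \<subseteq> gf2_space (Suc d)" "gf2.dim p = 1"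
    by (auto simp: pg2_points_def gf2_subspaces_def)
  obtain B where B: "B \<subseteq> p" "gf2.independent B" "p \<subseteq> gf2.span B" "card B = 1"
    using gf2.basis_exists[of p] sub(3) by metis
  then obtain v where v: "B = {v}"
    by (auto simp: card_1_singleton_iff)
  then have "v \<noteq> 0"
    using B(2) gf2.dependent_zero by auto
  moreover have "p = {0, v}"
    using B v sub gf2.span_minimal[of B p] by (auto simp: gf2_span_singleton)
  ultimately show "p \<in> (\<lambda>v. {0, v}) ` (gf2_space (Suc d) - {0})"
    using sub(2) by auto
next
  fix p assume "p \<in> (\<lambda>v. {0, v}) ` (gf2_space (Suc d) - {0})"
  then obtain v where v: "v \<in> gf2_space (Suc d)" "v \<noteq> 0" "p = gf2.span {v}"
    by (auto simp: gf2_span_singleton)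
  have "gf2.independent {v}"
    using v by simp
  then have "gf2.dim p = 1"
    unfolding v(3) using gf2.dim_span_eq_card_independent[of "{v}"] by simp
  moreover have "p \<subseteq> gf2_space (Suc d)"
    using v by (auto simp: gf2_span_singleton)
  ultimately show "p \<in> pg2_points d"
    using v(3) by (auto simp: pg2_points_def gf2_subspaces_def)
qed

text \<open>
  Over the field with two elements a projective point is the same thing as a nonzero vector.
  Adding one new point, labelled by the zero vector, to the point set of the design of hyperplane
  complements therefore turns projective into affine coordinates, and each block becomes the
  complement of a hyperplane of the coordinate space.
\<close>

lemma pg2_complement_design_labelling:
  assumes iso: "design_isomorphic (Z, \<A>) (pg2_complement_design d)"
    and sub: "\<And>A. A \<in> \<A> \<Longrightarrow> A \<subseteq> Z" and z: "z \<notin> Z"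
  obtains F where "bij_betw F (insert z Z) (gf2_space (Suc d))"
    and "\<And>A. A \<in> \<A> \<Longrightarrow>
      \<exists>U\<in>gf2_subspaces (Suc d) d. \<forall>x\<in>insert z Z. x \<in> A \<longleftrightarrow> F x \<notin> U"
proof -
  let ?V = "gf2_space (Suc d)"
  let ?point = "\<lambda>v :: nat \<Rightarrow> bit. {0, v}"
  obtain f where f: "bij_betw f Z (pg2_points d)"
    and blocks: "bij_betw ((`) f) \<A> {pg2_points d - H | H. H \<in> pg2_hyperplanes d}"
    using iso by (auto simp: design_isomorphic_def pg2_complement_design_def)
  have point: "bij_betw ?point (?V - {0}) (pg2_points d)"
    unfolding pg2_points_eq by (rule inj_on_imp_bij_betw) (auto simp: inj_on_def doubleton_eq_iff)
  define F where "F = (\<lambda>x. if x = z then 0 else inv_into (?V - {0}) ?point (f x))"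
  have F_z: "F z = 0"
    by (simp add: F_def)
  have F_Z: "bij_betw F Z (?V - {0})"
    using bij_betw_trans[OF f bij_betw_inv_into[OF point]] z
    by (subst bij_betw_cong[of Z F "inv_into (?V - {0}) ?point \<circ> f"]) (auto simp: F_def)
  have f_eq: "f x = {0, F x}" if "x \<in> Z" for x
  proof -
    have "f x \<in> pg2_points d"
      using f that by (auto simp: bij_betw_def)
    then have "?point (inv_into (?V - {0}) ?point (f x)) = f x"
      using bij_betw_inv_into_right[OF point] by blast
    then show ?thesis
      using that z by (auto simp: F_def)
  qed
  have "bij_betw F (insert z Z) (insert (F z) (?V - {0}))"
    using F_Z z F_z by (subst notIn_Un_bij_betw3[of z Z F "?V - {0}", simplified, symmetric]) auto
  then have "bij_betw F (insert z Z) ?V"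
    by (simp add: F_z insert_absorb)
  moreover have "\<exists>U\<in>gf2_subspaces (Suc d) d. \<forall>x\<in>insert z Z. x \<in> A \<longleftrightarrow> F x \<notin> U"
    if A: "A \<in> \<A>" for A
  proof -
    have "f ` A \<in> {pg2_points d - H | H. H \<in> pg2_hyperplanes d}"
      using blocks A by (auto simp: bij_betw_def)
    then obtain U where U: "U \<in> gf2_subspaces (Suc d) d"
      and fA: "f ` A = pg2_points d - {p \<in> pg2_points d. p \<subseteq> U}"
      by (auto simp: pg2_hyperplanes_def)
    have U0: "0 \<in> U"
      using U gf2.subspace_0 by (auto simp: gf2_subspaces_def)
    have "x \<in> A \<longleftrightarrow> F x \<notin> U" if "x \<in> Z" for x
    proof -
      have "x \<in> A \<longleftrightarrow> f x \<in> f ` A"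
        using f that sub[OF A] by (auto simp: bij_betw_def inj_on_def)
      also have "\<dots> \<longleftrightarrow> \<not> f x \<subseteq> U"
        using f that by (auto simp: fA bij_betw_def)
      also have "\<dots> \<longleftrightarrow> F x \<notin> U"
        using U0 by (simp add: f_eq[OF that])
      finally show ?thesis .
    qed
    moreover have "z \<in> A \<longleftrightarrow> F z \<notin> U"
      using sub[OF A] z U0 F_z by auto
    ultimately show ?thesis
      using U by blast
  qed
  ultimately show thesis
    using that by blast
qed

section \<open>The automorphism group of a design\<close>

lemma group_aut_group:
  assumes "\<B> \<subseteq> Pow P"
  shows "group (aut_group (P, \<B>))"
proof -
  let ?A = "{f \<in> Bij P. design_iso (P, \<B>) (P, \<B>) f}"
  interpret BP: group "BijGroup P"
    by (rule group_BijGroup)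
  have "subgroup ?A (BijGroup P)"
  proof (rule BP.subgroupI)
    show "?A \<subseteq> carrier (BijGroup P)"
      by (auto simp: BijGroup_def)
    have "bij_betw ((`) (\<lambda>x\<in>P. x)) \<B> \<B> \<longleftrightarrow> bij_betw id \<B> \<B>"
      using assms by (intro bij_betw_cong) auto
    then have "(\<lambda>x\<in>P. x) \<in> ?A"
      using id_Bij[of P] by (simp add: Bij_def)
    then show "?A \<noteq> {}"
      by blast
  next
    fix f assume "f \<in> ?A"
    then have f: "f \<in> Bij P" "bij_betw f P P" "bij_betw ((`) f) \<B> \<B>"
      by (auto simp: Bij_def)
    let ?g = "\<lambda>x\<in>P. inv_into P f x"
    have g: "?g \<in> Bij P"
      using f(1) by (rule restrict_inv_into_Bij)
    have "?g ` (f ` B) = B" if "B \<in> \<B>" for B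
    proof -
      have "B \<subseteq> P"
        using that assms by auto
      then have "?g ` (f ` B) = inv_into P f ` (f ` B)"
        using f(2) by (intro image_cong) (auto simp: bij_betw_def)
      also have "\<dots> = B"
        using f(2) \<open>B \<subseteq> P\<close> by (simp add: inv_into_image_cancel bij_betw_def)
      finally show ?thesis .
    qed
    then have "bij_betw ((`) ?g \<circ> (`) f) \<B> \<B> \<longleftrightarrow> bij_betw id \<B> \<B>"
      by (intro bij_betw_cong) simp
    then have "bij_betw ((`) ?g) \<B> \<B>"
      using bij_betw_comp_iff[OF f(3)] by blast
    then show "inv\<^bsub>BijGroup P\<^esub> f \<in> ?A"
      using g by (simp add: inv_BijGroup[OF f(1)] Bij_def)
  next
    fix f g assume "f \<in> ?A" "g \<in> ?A"
    then have fg: "f \<in> Bij P" "g \<in> Bij P" "bij_betw ((`) f) \<B> \<B>" "bij_betw ((`) g) \<B> \<B>"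
      by auto
    have "compose P f g ` B = f ` (g ` B)" if "B \<in> \<B>" for B
      using that assms by (force simp: compose_def)
    then have "bij_betw ((`) (compose P f g)) \<B> \<B> \<longleftrightarrow> bij_betw ((`) f \<circ> (`) g) \<B> \<B>"
      by (intro bij_betw_cong) auto
    then have "bij_betw ((`) (compose P f g)) \<B> \<B>"
      using bij_betw_trans[OF fg(4,3)] by simp
    then show "f \<otimes>\<^bsub>BijGroup P\<^esub> g \<in> ?A"
      using fg compose_Bij[OF fg(1,2)] by (simp add: BijGroup_def Bij_def)
  qed
  then show ?thesis
    unfolding aut_group_def by (simp add: subgroup.subgroup_is_group group_BijGroup)
qed

lemma mult_aut_group:
  "f \<in> Bij P \<Longrightarrow> g \<in> Bij P \<Longrightarrow> f \<otimes>\<^bsub>aut_group (P, \<B>)\<^esub> g = compose P f g"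
  by (simp add: aut_group_def BijGroup_def)

lemma one_aut_group: "\<one>\<^bsub>aut_group (P, \<B>)\<^esub> = (\<lambda>x\<in>P. x)"
  by (simp add: aut_group_def BijGroup_def)

section \<open>Translations of a labelled subset\<close>

locale gf2_labelling =
  fixes P C :: "'a set" and n :: nat and F :: "'a \<Rightarrow> nat \<Rightarrow> bit"
  assumes sub: "C \<subseteq> P" and bij: "bij_betw F C (gf2_space n)"
begin

definition shift :: "(nat \<Rightarrow> bit) \<Rightarrow> 'a \<Rightarrow> 'a" where
  "shift v = (\<lambda>x\<in>P. if x \<in> C then inv_into C F (F x + v) else x)"

lemma label_in: "x \<in> C \<Longrightarrow> F x \<in> gf2_space n"
  using bij by (auto simp: bij_betw_def)

lemma label_inj: "x \<in> C \<Longrightarrow> y \<in> C \<Longrightarrow> F x = F y \<Longrightarrow> x = y"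
  using bij by (auto simp: bij_betw_def inj_on_def)

lemma
  assumes "v \<in> gf2_space n" "x \<in> C"
  shows shift_in: "shift v x \<in> C" and label_shift: "F (shift v x) = F x + v"
proof -
  have "F x + v \<in> F ` C"
    using assms bij label_in add_in_gf2_space by (auto simp: bij_betw_def)
  then show "shift v x \<in> C" "F (shift v x) = F x + v"
    using assms sub by (auto simp: shift_def f_inv_into_f inv_into_into)
qed

lemma shift_outside: "x \<in> P - C \<Longrightarrow> shift v x = x"
  by (simp add: shift_def)

lemma shift_extensional: "shift v \<in> extensional P"
  by (simp add: shift_def)

lemma shift_eq_iff:
  assumes "v \<in> gf2_space n" "x \<in> C" "y \<in> C"
  shows "shift v x = y \<longleftrightarrow> F y = F x + v"
  using assms label_inj shift_in label_shift by metis

lemma shift_in_P: "v \<in> gf2_space n \<Longrightarrow> x \<in> P \<Longrightarrow> shift v x \<in> P"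
  using shift_in shift_outside sub by (cases "x \<in> C") auto

lemma shift_shift:
  assumes "u \<in> gf2_space n" "v \<in> gf2_space n" "x \<in> P"
  shows "shift u (shift v x) = shift (u + v) x"
proof (cases "x \<in> C")
  case True
  then show ?thesis
    using assms shift_in add_in_gf2_space
    by (intro label_inj) (simp_all add: label_shift add_ac)
qed (use assms in \<open>simp add: shift_outside\<close>)

lemma compose_shift:
  "u \<in> gf2_space n \<Longrightarrow> v \<in> gf2_space n \<Longrightarrow> compose P (shift u) (shift v) = shift (u + v)"
  by (rule extensionalityI[OF compose_extensional shift_extensional])
     (simp add: compose_eq shift_shift)

lemma shift_zero: "shift 0 = (\<lambda>x\<in>P. x)"
  using label_inj bij by (auto simp: shift_def fun_eq_iff bij_betw_inv_into_left)

lemma shift_Bij: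
  assumes "v \<in> gf2_space n"
  shows "shift v \<in> Bij P"
proof -
  have "bij_betw (shift v) P P"
    using assms by (intro bij_betw_byWitness[where f' = "shift v"])
      (auto simp: shift_shift shift_in_P shift_zero)
  then show ?thesis
    by (simp add: Bij_def shift_extensional)
qed

text \<open>
  The trace of \<open>B\<close> on \<open>C\<close> is one of the two cosets of a hyperplane. A translation either
  fixes both cosets or interchanges them, and it fixes every point of \<open>B\<close> outside \<open>C\<close>.
\<close>

lemma shift_image_cases:
  assumes U: "U \<in> gf2_subspaces n (n - 1)" and n: "n > 0" and B: "B \<subseteq> P"
    and mem: "\<And>x. x \<in> C \<Longrightarrow> x \<in> B \<longleftrightarrow> (F x \<in> U \<longleftrightarrow> b)" and v: "v \<in> gf2_space n"
  shows "shift v ` B = B \<or> shift v ` B = sym_diff C B"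
proof -
  obtain d where d: "n = Suc d"
    using n by (cases n) auto
  have img: "shift v ` B = {x \<in> P. shift v x \<in> B}"
    using v B shift_shift[OF v v] shift_in_P[OF v] by (force simp: shift_zero)
  have flip: "shift v x \<in> B \<longleftrightarrow> (x \<in> B \<longleftrightarrow> v \<in> U)" if "x \<in> C" for x
    using add_in_hyperplane_iff[of U d "F x" v] that U d v label_in
    by (auto simp: mem shift_in label_shift)
  show ?thesis
  proof (cases "v \<in> U")
    case True
    then have "shift v x \<in> B \<longleftrightarrow> x \<in> B" if "x \<in> P" for x
      using that flip shift_outside[of x v] by (cases "x \<in> C") auto
    then show ?thesis
      using B unfolding img by blast
  next
    case False
    then have "shift v x \<in> B \<longleftrightarrow> x \<in> sym_diff C B" if "x \<in> P" for x
      using that flip shift_outside[of x v] by (cases "x \<in> C") auto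
    then have "{x \<in> P. shift v x \<in> B} = sym_diff C B"
      using B sub by auto
    then show ?thesis
      unfolding img by (rule disjI2)
  qed
qed

end

locale block_preserving_labelling = gf2_labelling +
  fixes \<B> :: "'a set set"
  assumes finite_blocks: "finite \<B>" and blocks: "\<B> \<subseteq> Pow P"
    and shift_block: "v \<in> gf2_space n \<Longrightarrow> B \<in> \<B> \<Longrightarrow> shift v ` B \<in> \<B>"
begin

abbreviation "A \<equiv> aut_group (P, \<B>)"

abbreviation "shifts \<equiv> shift ` gf2_space n"

abbreviation "T \<equiv> A\<lparr>carrier := shifts\<rparr>"

lemma shift_aut:
  assumes v: "v \<in> gf2_space n"
  shows "shift v \<in> carrier A"
proof -
  have "inj_on (shift v) P"
    using shift_Bij[OF v] by (auto simp: Bij_def bij_betw_def)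
  then have "inj_on ((`) (shift v)) \<B>"
    using blocks by (meson inj_on_image_Pow inj_on_subset)
  moreover have "(`) (shift v) ` \<B> \<subseteq> \<B>"
    using shift_block[OF v] by blast
  ultimately have "bij_betw ((`) (shift v)) \<B> \<B>"
    using endo_inj_surj[OF finite_blocks] by (simp add: bij_betw_def)
  then show ?thesis
    using shift_Bij[OF v] by (auto simp: aut_group_def Bij_def)
qed

lemma shift_mult:
  assumes "u \<in> gf2_space n" "v \<in> gf2_space n"
  shows "shift u \<otimes>\<^bsub>A\<^esub> shift v = shift (u + v)"
  using assms by (simp add: mult_aut_group shift_Bij compose_shift)

lemma subgroup_shifts: "subgroup shifts A"
proof -
  interpret A: group A
    using blocks by (rule group_aut_group)
  show ?thesis
  proof (rule A.subgroupI)
    fix g assume "g \<in> shifts"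
    then obtain v where v: "v \<in> gf2_space n" "g = shift v"
      by auto
    have "inv\<^bsub>A\<^esub> g = g"
      using v by (intro A.inv_equality) (auto simp: shift_mult shift_aut shift_zero one_aut_group)
    then show "inv\<^bsub>A\<^esub> g \<in> shifts"
      using v by simp
  next
    show "shifts \<noteq> {}"
      using zero_in_gf2_space by blast
  qed (auto simp: shift_aut shift_mult add_in_gf2_space)
qed

lemma group_shifts: "group T"
  using subgroup_shifts group_aut_group[OF blocks] by (rule subgroup.subgroup_is_group)

lemma shift_eq_shift_iff:
  assumes "u \<in> gf2_space n" "v \<in> gf2_space n" "x \<in> C"
  shows "shift u x = shift v x \<longleftrightarrow> u = v"
  using assms by (metis add_left_cancel label_shift)

lemma labelled_nonempty: "C \<noteq> {}"
  using bij zero_in_gf2_space[of n] by (metis bij_betw_imp_surj_on empty_iff image_empty)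

lemma shifts_iso: "T \<cong> product_group {..<n} (\<lambda>_. integer_mod_group 2)"
proof -
  let ?Q = "product_group {..<n} (\<lambda>_. integer_mod_group 2)"
  define bits where "bits = (\<lambda>w i. if i < n \<and> w i = (1::int) then 1 else 0 :: bit)"
  have bits_in: "bits w \<in> gf2_space n" for w
    by (auto simp: bits_def gf2_space_def)
  have entry: "w i = 0 \<or> w i = 1" if "w \<in> carrier ?Q" "i < n" for w i
  proof -
    have "w i \<in> {0..<2}"
      using that by (auto simp: carrier_integer_mod_group PiE_iff)
    then show ?thesis
      by auto
  qed
  have "bij_betw bits (carrier ?Q) (gf2_space n)"
  proof (rule bij_betw_byWitness[where f' = "\<lambda>v. \<lambda>i\<in>{..<n}. if v i = 1 then 1 else 0"])
    show "\<forall>w\<in>carrier ?Q. (\<lambda>i\<in>{..<n}. if bits w i = 1 then 1 else 0) = w"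
    proof
      fix w assume w: "w \<in> carrier ?Q"
      have "w i = undefined" if "\<not> i < n" for i
        using that w by (auto simp: PiE_iff extensional_def)
      then show "(\<lambda>i\<in>{..<n}. if bits w i = 1 then 1 else 0) = w"
        using entry[OF w] by (auto simp: fun_eq_iff bits_def)
    qed
    show "\<forall>v\<in>gf2_space n. bits (\<lambda>i\<in>{..<n}. if v i = 1 then 1 else 0) = v"
      by (auto simp: fun_eq_iff bits_def gf2_space_def)
  qed (simp_all add: image_subset_iff bits_in carrier_integer_mod_group PiE_iff)
  moreover have "bij_betw shift (gf2_space n) shifts"
    using labelled_nonempty shift_eq_shift_iff
    by (intro inj_on_imp_bij_betw inj_onI) (metis ex_in_conv)
  ultimately have "bij_betw (shift \<circ> bits) (carrier ?Q) (carrier T)"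
    by (simp add: bij_betw_trans)
  moreover have "bits (w \<otimes>\<^bsub>?Q\<^esub> w') = bits w + bits w'"
    if "w \<in> carrier ?Q" "w' \<in> carrier ?Q" for w w'
  proof
    fix i
    have "(w i = 0 \<or> w i = 1) \<and> (w' i = 0 \<or> w' i = 1)" if "i < n"
      using that \<open>w \<in> _\<close> \<open>w' \<in> _\<close> by (simp add: entry)
    then show "bits (w \<otimes>\<^bsub>?Q\<^esub> w') i = (bits w + bits w') i"
      by (auto simp: bits_def product_group_def)
  qed
  then have "shift \<circ> bits \<in> hom ?Q T"
    by (auto simp: hom_def shift_mult bits_in simp del: carrier_product_group)
  ultimately have "?Q \<cong> T"
    by (auto simp: is_iso_def iso_def)
  moreover have "group ?Q"
    by simp
  ultimately show ?thesis
    using group.iso_sym by blast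
qed

lemma shifts_sharply_transitive: "sharply_transitive_on T C"
proof -
  have Bij: "restrict (shift v) C \<in> Bij C" if v: "v \<in> gf2_space n" for v
  proof -
    have "bij_betw (restrict (shift v) C) C C"
      using v sub by (intro bij_betw_byWitness[where f' = "shift v"])
        (auto simp: shift_shift shift_in shift_zero subset_iff)
    then show ?thesis
      by (simp add: Bij_def)
  qed
  have "(\<lambda>g. restrict g C) \<in> hom T (BijGroup C)"
  proof (rule homI)
    fix g h assume "g \<in> carrier T" "h \<in> carrier T"
    then obtain u v where uv: "u \<in> gf2_space n" "v \<in> gf2_space n" "g = shift u" "h = shift v"
      by auto
    have "restrict (shift (u + v)) C = compose C (restrict (shift u) C) (restrict (shift v) C)"
      using uv sub by (auto simp: fun_eq_iff compose_def shift_shift shift_in subset_iff)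
    then show "restrict (g \<otimes>\<^bsub>T\<^esub> h) C = restrict g C \<otimes>\<^bsub>BijGroup C\<^esub> restrict h C"
      using uv Bij by (simp add: shift_mult BijGroup_def)
  qed (use Bij in \<open>auto simp: BijGroup_def\<close>)
  then have "group_action T C (\<lambda>g. restrict g C)"
    by (simp add: group_action_def group_hom_def group_hom_axioms_def
        group_shifts group_BijGroup)
  moreover have "\<exists>g\<in>carrier T. restrict g C x = y" if xy: "x \<in> C" "y \<in> C" for x y
  proof -
    have v: "F x + F y \<in> gf2_space n"
      using xy by (simp add: label_in add_in_gf2_space)
    then have "shift (F x + F y) x = y"
      using xy by (simp add: shift_eq_iff)
    then show ?thesis
      using v xy by (intro bexI[of _ "shift (F x + F y)"]) auto
  qed
  ultimately have "transitive_action T C (\<lambda>g. restrict g C)"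
    by (simp add: transitive_action_def transitive_action_axioms_def)
  moreover have "stabilizer T (\<lambda>g. restrict g C) x = {\<one>\<^bsub>T\<^esub>}" if x: "x \<in> C" for x
  proof -
    have "shift v x = x \<longleftrightarrow> v = 0" if "v \<in> gf2_space n" for v
      using that x by (simp add: shift_eq_iff)
    then show ?thesis
      using x by (auto simp: stabilizer_def one_aut_group shift_zero[symmetric])
  qed
  ultimately show ?thesis
    by (simp add: sharply_transitive_on_def)
qed

end

section \<open>The group attached to a center block\<close>

theorem mainTheorem2:
  fixes k :: nat and P :: "'a set" and \<B> :: "'a set set" and C :: "'a set"
  assumes "k \<ge> 3"
    and "symmetric_design (2 ^ k - 1) (2 ^ (k - 1)) (2 ^ (k - 2)) (P, \<B>)"
    and "center_block (P, \<B>) C"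
    and "\<And>Z. Z \<subseteq> C \<Longrightarrow> card Z = 2 ^ (k - 1) - 1 \<Longrightarrow>
           design_isomorphic (derived_design (P, \<B>) C Z) (pg2_complement_design (k - 2))"
  shows "\<exists>G. subgroup G (aut_group (P, \<B>)) \<and>
           (aut_group (P, \<B>)\<lparr>carrier := G\<rparr>) \<cong>
             product_group {..<k - 1} (\<lambda>_. integer_mod_group 2) \<and>
           sharply_transitive_on (aut_group (P, \<B>)\<lparr>carrier := G\<rparr>) C \<and>
           (\<forall>g\<in>G. \<forall>x\<in>P - C. g x = x)"
proof -
  have blocks: "\<B> \<subseteq> Pow P" "finite \<B>" and C: "C \<in> \<B>" "card C = 2 ^ (k - 1)"
    and center: "\<And>B. B \<in> \<B> \<Longrightarrow> B \<noteq> C \<Longrightarrow> sym_diff C B \<in> \<B>"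
    using assms(2,3) by auto
  have k: "Suc (k - 2) = k - 1"
    using assms(1) by simp
  have "card C > 0"
    using C by simp
  then obtain z where z: "z \<in> C"
    by (metis card.empty ex_in_conv less_irrefl)
  define Z where "Z = C - {z}"
  define \<A> where "\<A> = {B \<inter> C | B. B \<in> \<B> \<and> B \<noteq> C \<and> B \<inter> C \<subseteq> Z}"
  have C_eq: "insert z Z = C"
    using z by (auto simp: Z_def)
  have "card Z = 2 ^ (k - 1) - 1"
    using z C by (simp add: Z_def)
  then have "design_isomorphic (Z, \<A>) (pg2_complement_design (k - 2))"
    using assms(4)[of Z] by (auto simp: Z_def \<A>_def)
  then obtain F where F: "bij_betw F C (gf2_space (k - 1))"
    and trace: "\<And>A. A \<in> \<A> \<Longrightarrow>
      \<exists>U\<in>gf2_subspaces (k - 1) (k - 2). \<forall>x\<in>C. x \<in> A \<longleftrightarrow> F x \<notin> U"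
    by (rule pg2_complement_design_labelling[of Z \<A> "k - 2" z, unfolded C_eq k])
       (auto simp: \<A>_def Z_def)
  interpret gf2_labelling P C "k - 1" F
    using F blocks C by unfold_locales auto
  have shift_block: "shift v ` B \<in> \<B>" if v: "v \<in> gf2_space (k - 1)" and B: "B \<in> \<B>" for v B
  proof (cases "B = C")
    case True
    have "shift v ` C = C"
      using v sub shift_in shift_shift[OF v v] by (force simp: shift_zero subset_iff)
    then show ?thesis
      using B True by simp
  next
    case False
    obtain U b where U: "U \<in> gf2_subspaces (k - 1) (k - 2)"
      and mem: "\<And>x. x \<in> C \<Longrightarrow> x \<in> B \<longleftrightarrow> (F x \<in> U \<longleftrightarrow> b)"
    proof (cases "z \<in> B")
      case True
      \<comment> \<open>The trace of \<open>B\<close> is not a block of the derived design, but its complement in \<open>C\<close>,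
        the trace of the symmetric difference, is.\<close>
      have "sym_diff C B \<inter> C \<in> \<A>"
        unfolding \<A>_def using center[OF B False] True z by (auto simp: Z_def)
      then obtain U where "U \<in> gf2_subspaces (k - 1) (k - 2)"
        "\<forall>x\<in>C. x \<in> sym_diff C B \<inter> C \<longleftrightarrow> F x \<notin> U"
        using trace by blast
      then show thesis
        using that[of U True] by blast
    next
      case zB: False
      have "B \<inter> C \<in> \<A>"
        unfolding \<A>_def using B False zB by (auto simp: Z_def)
      then obtain U where "U \<in> gf2_subspaces (k - 1) (k - 2)"
        "\<forall>x\<in>C. x \<in> B \<inter> C \<longleftrightarrow> F x \<notin> U"
        using trace by blast
      then show thesis
        using that[of U False] by blast
    qed
    have "k - 1 - 1 = k - 2" "k - 1 > 0"
      using assms(1) by auto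
    then have "shift v ` B = B \<or> shift v ` B = sym_diff C B"
      using shift_image_cases[of U B b v] U mem v B blocks by auto
    then show ?thesis
      using B center[OF B False] by auto
  qed
  interpret block_preserving_labelling P C "k - 1" F \<B>
    using blocks shift_block by unfold_locales auto
  show ?thesis
    using subgroup_shifts shifts_iso shifts_sharply_transitive shift_outside
    by (intro exI[of _ shifts]) auto
qed

end
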